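(* Let $\mathbf{A}$ be a distributive nearlattice. Then the following are equivalent: (1) $\mathbf{A}$ is Stone; (2) every element of $\mathrm{R}(A)=\{a^{\top}\colon a\in A\}$ has a complement in the lattice $\mathrm{Fi}(A)$, i.e. for each $a\in A$ there is a filter $F$ with $a^{\top}\cap F=\{1\}$ and $a^{\top}\veebar F=A$.
   Context: A distributive nearlattice is a join-semilattice $\langle A,\vee,1\rangle$ with greatest element $1$ in which every principal filter $[a)=\{x\in A\colon a\le x\}$ is a bounded distributive lattice. A filter of $A$ is a subset containing $1$, upward closed, and closed under those binary meets that exist; $\mathrm{Fi}(A)$ is the lattice of filters ordered by inclusion, with meet $\cap$, join $F\veebar G$ the smallest filter containing $F\cup G$, least element $\{1\}$ and greatest element $A$. For $a\in A$, $a^{\top}=\{x\in A\colon x\vee a=1\}$ and $a^{\top\top}=\{y\in A\colon y\vee x=1\text{ for all }x\in a^{\top}\}$. $\mathbf{A}$ is Stone if $a^{\top}\veebar a^{\top\top}=A$ for every $a\in A$. *)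

theory Defs
  imports "HOL-Algebra.Lattice"
begin

locale bounded_distributive_lattice = bounded_lattice +
  assumes meet_join_distrib:
    "\<lbrakk>x \<in> carrier L; y \<in> carrier L; z \<in> carrier L\<rbrakk> \<Longrightarrow>
      x \<sqinter> (y \<squnion> z) = (x \<sqinter> y) \<squnion> (x \<sqinter> z)"

definition principal_filter :: "('a, 'b) gorder_scheme \<Rightarrow> 'a \<Rightarrow> 'a set"
  where "principal_filter A a = {x \<in> carrier A. a \<sqsubseteq>\<^bsub>A\<^esub> x}"

text \<open>The principal filter carries the induced order, so the lattice operations below are those
  of the ordered set \<open>[a)\<close> itself. The greatest element \<open>1\<close> is \<open>\<top>\<close>.\<close>

locale distributive_nearlattice = upper_semilattice A + weak_partial_order_top A
  for A (structure) +
  assumes principal_filter_lattice: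
    "a \<in> carrier A \<Longrightarrow> bounded_distributive_lattice (A\<lparr>carrier := principal_filter A a\<rparr>)"

definition nl_filter :: "('a, 'b) gorder_scheme \<Rightarrow> 'a set \<Rightarrow> bool"
  where "nl_filter A F \<longleftrightarrow>
    F \<subseteq> carrier A \<and> \<top>\<^bsub>A\<^esub> \<in> F \<and>
    (\<forall>x\<in>F. \<forall>y\<in>carrier A. x \<sqsubseteq>\<^bsub>A\<^esub> y \<longrightarrow> y \<in> F) \<and>
    (\<forall>x\<in>F. \<forall>y\<in>F. \<forall>m. is_glb A m {x, y} \<longrightarrow> m \<in> F)"

definition Fi :: "('a, 'b) gorder_scheme \<Rightarrow> 'a set set"
  where "Fi A = {F. nl_filter A F}"

definition filter_join :: "('a, 'b) gorder_scheme \<Rightarrow> 'a set \<Rightarrow> 'a set \<Rightarrow> 'a set"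
  where "filter_join A F G = \<Inter>{H \<in> Fi A. F \<union> G \<subseteq> H}"

definition ann :: "('a, 'b) gorder_scheme \<Rightarrow> 'a \<Rightarrow> 'a set"
  where "ann A a = {x \<in> carrier A. x \<squnion>\<^bsub>A\<^esub> a = \<top>\<^bsub>A\<^esub>}"

definition ann_ann :: "('a, 'b) gorder_scheme \<Rightarrow> 'a \<Rightarrow> 'a set"
  where "ann_ann A a = {y \<in> carrier A. \<forall>x\<in>ann A a. y \<squnion>\<^bsub>A\<^esub> x = \<top>\<^bsub>A\<^esub>}"

definition stone :: "('a, 'b) gorder_scheme \<Rightarrow> bool"
  where "stone A \<longleftrightarrow> (\<forall>a\<in>carrier A. filter_join A (ann A a) (ann_ann A a) = carrier A)"

definition R :: "('a, 'b) gorder_scheme \<Rightarrow> 'a set set"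
  where "R A = {ann A a | a. a \<in> carrier A}"

definition complement_in_Fi :: "('a, 'b) gorder_scheme \<Rightarrow> 'a set \<Rightarrow> 'a set \<Rightarrow> bool"
  where "complement_in_Fi A G F \<longleftrightarrow>
    F \<in> Fi A \<and> G \<inter> F = {\<top>\<^bsub>A\<^esub>} \<and> filter_join A G F = carrier A"

context distributive_nearlattice
begin

lemma FiI:
  assumes "F \<subseteq> carrier A" "\<top> \<in> F"
    and "\<And>x y. \<lbrakk>x \<in> F; y \<in> carrier A; x \<sqsubseteq> y\<rbrakk> \<Longrightarrow> y \<in> F"
    and "\<And>x y m. \<lbrakk>x \<in> F; y \<in> F; is_glb A m {x, y}\<rbrakk> \<Longrightarrow> m \<in> F"
  shows "F \<in> Fi A"
  unfolding Fi_def nl_filter_def mem_Collect_eq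
  by (intro conjI ballI allI impI assms(1,2)) (erule (2) assms(3), erule (2) assms(4))

lemma FiD:
  assumes "F \<in> Fi A"
  shows "F \<subseteq> carrier A" "\<top> \<in> F"
    and "\<lbrakk>x \<in> F; y \<in> carrier A; x \<sqsubseteq> y\<rbrakk> \<Longrightarrow> y \<in> F"
    and "\<lbrakk>x \<in> F; y \<in> F; is_glb A m {x, y}\<rbrakk> \<Longrightarrow> m \<in> F"
  using assms unfolding Fi_def nl_filter_def mem_Collect_eq by (elim conjE; assumption | meson)+

lemma carrier_in_Fi: "carrier A \<in> Fi A"
proof (rule FiI)
  show "m \<in> carrier A" if "is_glb A m {x, y}" for x y m
    using that by (simp add: greatest_def Lower_def)
qed (use top_closed in simp_all)

lemma Inter_in_Fi:
  assumes S: "S \<subseteq> Fi A" "S \<noteq> {}" shows "\<Inter>S \<in> Fi A"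
proof (rule FiI)
  obtain H where "H \<in> S" using S(2) by blast
  then show "\<Inter>S \<subseteq> carrier A" using FiD(1)[OF subsetD[OF S(1)]] Inter_lower subset_trans by metis
  show "\<top> \<in> \<Inter>S" using FiD(2)[OF subsetD[OF S(1)]] by (rule InterI)
next
  fix x y assume xy: "x \<in> \<Inter>S" "y \<in> carrier A" "x \<sqsubseteq> y"
  show "y \<in> \<Inter>S"
  proof
    fix H assume H: "H \<in> S"
    show "y \<in> H" by (rule FiD(3)[OF subsetD[OF S(1) H] InterD[OF xy(1) H] xy(2,3)])
  qed
next
  fix x y m assume xym: "x \<in> \<Inter>S" "y \<in> \<Inter>S" "is_glb A m {x, y}"
  show "m \<in> \<Inter>S"
  proof
    fix H assume H: "H \<in> S"
    show "m \<in> H"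
      by (rule FiD(4)[OF subsetD[OF S(1) H] InterD[OF xym(1) H] InterD[OF xym(2) H] xym(3)])
  qed
qed

lemma top_singleton_in_Fi: "{\<top>} \<in> Fi A"
proof -
  have "m = \<top>" if "is_glb A m {\<top>, \<top>}" for m
  proof -
    have "\<top> \<in> Lower A {\<top>, \<top>}" using top_closed by (auto simp: Lower_def)
    then have "\<top> \<sqsubseteq> m" "m \<in> carrier A"
      using that by (auto simp: greatest_def Lower_def)
    then show ?thesis by (intro le_antisym top_higher top_closed)
  qed
  moreover have "y = \<top>" if "y \<in> carrier A" "\<top> \<sqsubseteq> y" for y
    using that by (intro le_antisym top_higher top_closed)
  ultimately show ?thesis using top_closed by (intro FiI) simp_all
qed

lemma filter_join_in_Fi:
  assumes "F \<in> Fi A" "G \<in> Fi A" shows "filter_join A F G \<in> Fi A"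
  unfolding filter_join_def
proof (rule Inter_in_Fi)
  have "F \<union> G \<subseteq> carrier A" using assms FiD(1) by simp
  then show "{H \<in> Fi A. F \<union> G \<subseteq> H} \<noteq> {}" using carrier_in_Fi by blast
qed simp

lemma Fi_operations:
  fixes L defines "L \<equiv> \<lparr>carrier = Fi A, eq = (=), le = (\<subseteq>)\<rparr>"
  assumes FG: "F \<in> Fi A" "G \<in> Fi A"
  shows "is_glb L (F \<inter> G) {F, G}" "is_lub L (filter_join A F G) {F, G}"
    and "least L {\<top>} (Fi A)" "greatest L (carrier A) (Fi A)"
proof -
  have "F \<inter> G \<in> Fi A" using Inter_in_Fi[of "{F, G}"] FG by simp
  then show "is_glb L (F \<inter> G) {F, G}"
    using FG by (auto simp: L_def greatest_def Lower_def)
  have "F \<subseteq> filter_join A F G" "G \<subseteq> filter_join A F G"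
    and "\<forall>H\<in>Fi A. F \<subseteq> H \<longrightarrow> G \<subseteq> H \<longrightarrow> filter_join A F G \<subseteq> H"
    unfolding filter_join_def by blast+
  then show "is_lub L (filter_join A F G) {F, G}"
    using FG filter_join_in_Fi[OF FG] by (simp add: L_def least_def Upper_def)
  show "least L {\<top>} (Fi A)"
    using top_singleton_in_Fi FiD(2) by (simp add: L_def least_def)
  show "greatest L (carrier A) (Fi A)"
    using carrier_in_Fi FiD(1) by (simp add: L_def greatest_def)
qed

end

end

theory Submission
  imports Defs
begin

text \<open>The double annihilator \<open>a\<^sup>\<top>\<^sup>\<top>\<close> is a filter meeting \<open>a\<^sup>\<top>\<close> only in \<open>1\<close>: if \<open>m = x \<sqinter> y\<close> and
  \<open>w \<ge> m\<close> has join \<open>1\<close> with both \<open>x\<close> and \<open>y\<close>, then distributivity in \<open>[m)\<close> gives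
  \<open>x = x \<sqinter> (y \<squnion> w) = m \<squnion> (x \<sqinter> w) \<le> w\<close>, so \<open>w = x \<squnion> w = 1\<close>. Hence in a Stone nearlattice
  \<open>a\<^sup>\<top>\<^sup>\<top>\<close> complements \<open>a\<^sup>\<top>\<close>. Conversely, any complement \<open>F\<close> of \<open>a\<^sup>\<top>\<close> lies in \<open>a\<^sup>\<top>\<^sup>\<top>\<close>, because
  \<open>x \<squnion> y \<in> F \<inter> a\<^sup>\<top>\<close> for \<open>x \<in> F\<close> and \<open>y \<in> a\<^sup>\<top>\<close>.\<close>

text \<open>Larger arguments leave fewer filters in the defining intersection.\<close>

lemma filter_join_mono:
  assumes "F \<subseteq> F'" "G \<subseteq> G'"
  shows "filter_join A F G \<subseteq> filter_join A F' G'"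
  using assms unfolding filter_join_def by blast

context distributive_nearlattice
begin

lemma top_unique:
  assumes "x \<in> carrier A" "\<top> \<sqsubseteq> x"
  shows "x = \<top>"
  using assms by (intro le_antisym top_higher top_closed)

lemma join_eq_top_mono:
  assumes "x \<squnion> z = \<top>" "x \<sqsubseteq> y" "x \<in> carrier A" "y \<in> carrier A" "z \<in> carrier A"
  shows "y \<squnion> z = \<top>"
proof -
  have "x \<squnion> z \<sqsubseteq> y \<squnion> z"
    using assms by (intro join_le join_closed) (auto intro: le_trans join_left join_right)
  then show ?thesis using assms by (intro top_unique) auto
qed

lemma glb_join_eq_top:
  assumes m: "is_glb A m {x, y}"
    and carr: "x \<in> carrier A" "y \<in> carrier A" "w \<in> carrier A"
    and mw: "m \<sqsubseteq> w" and top: "x \<squnion> w = \<top>" "y \<squnion> w = \<top>"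
  shows "w = \<top>"
proof -
  have mc: "m \<in> carrier A" and mx: "m \<sqsubseteq> x" and my: "m \<sqsubseteq> y"
    and mg: "\<And>l. \<lbrakk>l \<in> carrier A; l \<sqsubseteq> x; l \<sqsubseteq> y\<rbrakk> \<Longrightarrow> l \<sqsubseteq> m"
    using m carr by (auto simp: greatest_def Lower_def)
  define B where "B = A\<lparr>carrier := principal_filter A m\<rparr>"
  interpret B: bounded_distributive_lattice B
    unfolding B_def by (rule principal_filter_lattice[OF mc])
  have le: "le B = le A" and cB: "\<And>z. z \<in> carrier B \<longleftrightarrow> z \<in> carrier A \<and> m \<sqsubseteq> z"
    by (auto simp: B_def principal_filter_def)
  have inB: "x \<in> carrier B" "y \<in> carrier B" "w \<in> carrier B" "m \<in> carrier B"
    using carr mc mx my mw by (auto simp: cB)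
  let ?u = "y \<squnion>\<^bsub>B\<^esub> w" and ?v = "x \<sqinter>\<^bsub>B\<^esub> w" and ?p = "x \<sqinter>\<^bsub>B\<^esub> y"
  have uB: "?u \<in> carrier B" and vB: "?v \<in> carrier B" and pB: "?p \<in> carrier B"
    using inB by auto
  \<comment> \<open>\<open>B\<close> shares its order with \<open>A\<close>, so \<open>?u\<close>
    bounds \<open>y\<close> and \<open>w\<close> in \<open>A\<close> too and lies above their join
    there, which is \<open>\<top>\<close>.\<close>
  have "y \<sqsubseteq> ?u" "w \<sqsubseteq> ?u"
    using B.join_left[of y w] B.join_right[of y w] inB by (auto simp: le)
  then have "y \<squnion> w \<sqsubseteq> ?u" using carr uB by (intro join_le) (auto simp: cB)
  then have u: "?u = \<top>" using uB top by (intro top_unique) (auto simp: cB)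
  \<comment> \<open>As a common lower bound, \<open>?p\<close> lies below \<open>m\<close>, the
    least element of \<open>B\<close>, so \<open>?v\<close> absorbs it.\<close>
  have "?p \<sqsubseteq> x" "?p \<sqsubseteq> y"
    using B.meet_left[of x y] B.meet_right[of x y] inB by (auto simp: le)
  then have "?p \<sqsubseteq> m" using mg pB by (auto simp: cB)
  moreover have v: "m \<sqsubseteq> ?v" using vB by (simp add: cB)
  ultimately have "?p \<sqsubseteq> ?v" using pB vB mc by (auto simp: cB intro: le_trans)
  then have "?p \<squnion>\<^bsub>B\<^esub> ?v \<sqsubseteq> ?v"
    using B.join_le[of ?p ?v ?v] B.le_refl[OF vB] pB vB by (simp add: le)
  \<comment> \<open>Here \<open>?u = \<top>\<close>, so \<open>x\<close> is a lower bound of both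
    arguments.\<close>
  moreover have "x \<sqsubseteq> x \<sqinter>\<^bsub>B\<^esub> ?u"
    using B.meet_le[of x x ?u] B.le_refl[of x] inB uB carr u by (simp add: le)
  moreover have "x \<sqinter>\<^bsub>B\<^esub> ?u = ?p \<squnion>\<^bsub>B\<^esub> ?v"
    using B.meet_join_distrib inB by simp
  moreover have "?p \<squnion>\<^bsub>B\<^esub> ?v \<in> carrier A" "?v \<in> carrier A"
    using B.join_closed[OF pB vB] vB by (auto simp: cB)
  ultimately have "x \<sqsubseteq> ?v" using carr by (auto intro: le_trans)
  moreover have "?v \<sqsubseteq> w" using B.meet_right[of x w] inB by (auto simp: le)
  ultimately have "x \<sqsubseteq> w" using carr \<open>?v \<in> carrier A\<close> by (auto intro: le_trans)
  then have "x \<squnion> w \<sqsubseteq> w" using carr by (intro join_le) auto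
  then show ?thesis using top carr by (intro top_unique) auto
qed

lemma top_join: "x \<in> carrier A \<Longrightarrow> \<top> \<squnion> x = \<top>"
  by (intro top_unique join_closed join_left top_closed)

lemma ann_ann_in_Fi: "ann_ann A a \<in> Fi A"
proof (rule FiI)
  show "\<top> \<in> ann_ann A a"
    by (auto simp: ann_ann_def ann_def top_join)
  show "y \<in> ann_ann A a" if "x \<in> ann_ann A a" "y \<in> carrier A" "x \<sqsubseteq> y" for x y
    using that by (auto simp: ann_ann_def ann_def intro: join_eq_top_mono[of x])
next
  fix x y m assume x: "x \<in> ann_ann A a" and y: "y \<in> ann_ann A a" and m: "is_glb A m {x, y}"
  have xyc: "x \<in> carrier A" "y \<in> carrier A" using x y by (auto simp: ann_ann_def)
  have mc: "m \<in> carrier A" using m by (auto simp: greatest_def Lower_def)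
  \<comment> \<open>Apply \<open>glb_join_eq_top\<close> with \<open>w = m \<squnion> z\<close>,
    which is above \<open>m\<close>; its joins with \<open>x\<close> and \<open>y\<close> dominate
    \<open>x \<squnion> z\<close> and \<open>y \<squnion> z\<close>.\<close>
  have "m \<squnion> z = \<top>" if z: "z \<in> ann A a" for z
  proof (rule glb_join_eq_top[OF m xyc])
    have zc: "z \<in> carrier A" using z by (simp add: ann_def)
    then show "m \<squnion> z \<in> carrier A" "m \<sqsubseteq> m \<squnion> z" using mc by (auto intro: join_left)
    have "t \<squnion> (m \<squnion> z) = \<top>" if "t \<in> ann_ann A a" for t
    proof -
      have tc: "t \<in> carrier A" and tz: "t \<squnion> z = \<top>" using that z by (auto simp: ann_ann_def)
      have "t \<squnion> z \<sqsubseteq> t \<squnion> (m \<squnion> z)"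
      proof (rule join_le)
        show "z \<sqsubseteq> t \<squnion> (m \<squnion> z)"
          using tc mc zc by (intro le_trans[OF join_right join_right]) auto
      qed (use tc mc zc join_left in auto)
      then show ?thesis using tc mc zc tz by (intro top_unique) auto
    qed
    then show "x \<squnion> (m \<squnion> z) = \<top>" "y \<squnion> (m \<squnion> z) = \<top>" using x y by auto
  qed
  then show "m \<in> ann_ann A a" using mc by (simp add: ann_ann_def)
qed (auto simp: ann_ann_def)

text \<open>A common element \<open>x\<close> annihilates itself, and
  \<open>x \<squnion> x = \<top>\<close> forces \<open>x = \<top>\<close>.\<close>

lemma ann_Int_ann_ann:
  assumes "a \<in> carrier A"
  shows "ann A a \<inter> ann_ann A a = {\<top>}"
proof
  show "ann A a \<inter> ann_ann A a \<subseteq> {\<top>}"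
  proof
    fix x assume "x \<in> ann A a \<inter> ann_ann A a"
    then have xc: "x \<in> carrier A" and "x \<squnion> x = \<top>" by (auto simp: ann_ann_def ann_def)
    moreover have "x \<squnion> x \<sqsubseteq> x" using xc by (intro join_le) auto
    ultimately show "x \<in> {\<top>}" using top_unique by simp
  qed
  show "{\<top>} \<subseteq> ann A a \<inter> ann_ann A a"
    using assms FiD(2)[OF ann_ann_in_Fi] by (simp add: ann_def top_join)
qed

text \<open>With the two preceding lemmas, this makes \<open>ann_ann A a\<close> the greatest filter
  meeting \<open>ann A a\<close> trivially.\<close>

lemma disjoint_filter_subset_ann_ann:
  assumes a: "a \<in> carrier A" and F: "F \<in> Fi A" and disj: "ann A a \<inter> F = {\<top>}"
  shows "F \<subseteq> ann_ann A a"
proof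
  fix x assume x: "x \<in> F"
  then have xc: "x \<in> carrier A" using FiD(1)[OF F] by blast
  have "x \<squnion> y = \<top>" if y: "y \<in> ann A a" for y
  proof -
    have yc: "y \<in> carrier A" and ya: "y \<squnion> a = \<top>" using y by (auto simp: ann_def)
    have "x \<squnion> y \<in> F" using FiD(3)[OF F x] xc yc join_left by auto
    moreover have "(x \<squnion> y) \<squnion> a = \<top>"
      using join_eq_top_mono[OF ya] join_right xc yc a by auto
    ultimately show ?thesis using disj xc yc by (auto simp: ann_def)
  qed
  then show "x \<in> ann_ann A a" using xc by (simp add: ann_ann_def)
qed

end

theorem theorem4p5:
  fixes A :: "('a, 'b) gorder_scheme"
  assumes "distributive_nearlattice A"
  shows "stone A \<longleftrightarrow> (\<forall>G\<in>R A. \<exists>F. complement_in_Fi A G F)"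
proof -
  interpret distributive_nearlattice A by (rule assms)
  show ?thesis
  proof
    assume "stone A"
    then have "complement_in_Fi A (ann A a) (ann_ann A a)" if "a \<in> carrier A" for a
      using that ann_ann_in_Fi ann_Int_ann_ann by (simp add: stone_def complement_in_Fi_def)
    then show "\<forall>G\<in>R A. \<exists>F. complement_in_Fi A G F" by (auto simp: R_def)
  next
    assume compl: "\<forall>G\<in>R A. \<exists>F. complement_in_Fi A G F"
    show "stone A" unfolding stone_def
    proof
      fix a assume a: "a \<in> carrier A"
      then obtain F where F: "F \<in> Fi A" "ann A a \<inter> F = {\<top>\<^bsub>A\<^esub>}"
        and join: "filter_join A (ann A a) F = carrier A"
        using compl by (auto simp: R_def complement_in_Fi_def)
      \<comment> \<open>The join with \<open>F\<close> is already everything, and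
        \<open>ann_ann A a\<close> contains \<open>F\<close>.\<close>
      have "carrier A \<subseteq> filter_join A (ann A a) (ann_ann A a)"
        using filter_join_mono[OF subset_refl disjoint_filter_subset_ann_ann[OF a F]]
        by (metis join)
      \<comment> \<open>\<open>carrier A\<close> is one of the filters being intersected.\<close>
      moreover have "filter_join A (ann A a) (ann_ann A a) \<subseteq> carrier A"
        using carrier_in_Fi by (auto simp: filter_join_def ann_def ann_ann_def)
      ultimately show "filter_join A (ann A a) (ann_ann A a) = carrier A" by simp
    qed
  qed
qed

end
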